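(* Let $f(z)=z+a_2z^2+a_3z^3+\cdots\in\mathcal{S}^{*}_{\arcsin}$. Then $$|a_2|\le \frac{2}{\pi},\qquad |a_3|\le \frac{1}{\pi},\qquad |a_4|\le \frac{2}{3\pi}.$$ All three inequalities are sharp, i.e. for each of them there is a function in $\mathcal{S}^{*}_{\arcsin}$ for which equality holds.
   Context: Let $\Omega=\{z\in\mathbb{C}:|z|<1\}$. Let $\mathcal{A}$ be the family of analytic functions $f$ on $\Omega$ normalized by $f(z)=z+\sum_{n\ge 2}a_nz^n$, and let $\mathcal{S}\subset\mathcal{A}$ be the subclass of univalent (injective) functions. A Schwarz function is an analytic function $\omega$ on $\Omega$ with $\omega(0)=0$ and $|\omega(z)|\le 1$ for all $z\in\Omega$. For $g,h$ analytic in $\Omega$, $g\prec h$ ($g$ is subordinate to $h$) means there is a Schwarz function $\omega$ with $g(z)=h(\omega(z))$ for all $z\in\Omega$. With $\arcsin$ denoting the principal branch (analytic in $\Omega$, $\arcsin 0=0$), define $$\mathcal{S}^{*}_{\arcsin}=\left\{f\in\mathcal{S}:\ \frac{zf'(z)}{f(z)}\prec 1+\frac{2}{\pi}\arcsin z\right\},$$ where $zf'(z)/f(z)$ is understood to take the value $1$ at $z=0$. *)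

theory Defs
  imports "HOL-Complex_Analysis.Complex_Analysis"
begin

text \<open>
  Functions on the open unit disc are total functions on \<^typ>\<open>complex\<close> whose values outside the
  disc are irrelevant; \<^const>\<open>deriv\<close> at a point of the disc only depends on values inside it.
\<close>

abbreviation unit_disc :: "complex set" where
  "unit_disc \<equiv> ball 0 1"

abbreviation taylor_coeff :: "(complex \<Rightarrow> complex) \<Rightarrow> nat \<Rightarrow> complex" where
  "taylor_coeff f n \<equiv> fps_nth (fps_expansion f 0) n"

definition class_A :: "(complex \<Rightarrow> complex) set" where
  "class_A = {f. f holomorphic_on unit_disc \<and> taylor_coeff f 0 = 0 \<and> taylor_coeff f 1 = 1}"

definition class_S :: "(complex \<Rightarrow> complex) set" where
  "class_S = {f \<in> class_A. inj_on f unit_disc}"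

definition schwarz_function :: "(complex \<Rightarrow> complex) \<Rightarrow> bool" where
  "schwarz_function \<omega> \<longleftrightarrow>
     \<omega> holomorphic_on unit_disc \<and> \<omega> 0 = 0 \<and> (\<forall>z\<in>unit_disc. norm (\<omega> z) \<le> 1)"

definition subordinate :: "(complex \<Rightarrow> complex) \<Rightarrow> (complex \<Rightarrow> complex) \<Rightarrow> bool"
    (infix "\<prec>\<^sub>s" 50) where
  "g \<prec>\<^sub>s h \<longleftrightarrow> (\<exists>\<omega>. schwarz_function \<omega> \<and> (\<forall>z\<in>unit_disc. g z = h (\<omega> z)))"

text \<open>
  The quotient has a removable singularity at the origin, where its value is 1. For univalent
  \<open>f\<close> with \<open>f 0 = 0\<close> the denominator vanishes nowhere else in the disc.
\<close>

definition starlike_quotient :: "(complex \<Rightarrow> complex) \<Rightarrow> complex \<Rightarrow> complex" where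
  "starlike_quotient f z = (if z = 0 then 1 else z * deriv f z / f z)"

definition starlike_arcsin :: "(complex \<Rightarrow> complex) set" where
  "starlike_arcsin =
     {f \<in> class_S. starlike_quotient f \<prec>\<^sub>s (\<lambda>z. 1 + 2 / of_real pi * Arcsin z)}"

end

theory Submission
  imports Defs
begin

text \<open>
  Comparing coefficients in \<open>z f'(z) = f(z) (1 + 2/\<pi> arcsin \<omega>(z))\<close> expresses \<open>a\<^sub>2, a\<^sub>3, a\<^sub>4\<close> by the
  coefficients \<open>c\<^sub>1, c\<^sub>2, c\<^sub>3\<close> of the Schwarz function \<open>\<omega>\<close>. The Schur algorithm parametrises these as
  \<open>c\<^sub>2 = (1 - |c\<^sub>1|\<^sup>2) x\<close> and \<open>c\<^sub>3 = (1 - |c\<^sub>1|\<^sup>2) (y - cnj c\<^sub>1 x\<^sup>2)\<close> with \<open>|y| \<le> 1 - |x|\<^sup>2\<close>; the parameters in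
  the resulting functional \<open>c\<^sub>3 + \<mu> c\<^sub>1 c\<^sub>2 + \<nu> c\<^sub>1\<^sup>3\<close> are so small that the triangle inequality suffices.
  Equality holds for \<open>\<omega>(z) = z, z\<^sup>2, z\<^sup>3\<close>. That the solution \<open>f\<close> is univalent in these cases is seen in the
  logarithmic coordinate \<open>z = e\<^sup>s\<close>: there \<open>log f(e\<^sup>s)\<close> has a derivative of positive real part on a
  half-plane, hence is injective, and it commutes with the translation by \<open>2\<pi>\<i>\<close>.
\<close>

section \<open>Coefficients of bounded functions\<close>

lemma fps_expansion_eqI:
  assumes "F has_fps_expansion A" "\<And>z. z \<in> unit_disc \<Longrightarrow> f z = F z"
  shows "fps_expansion f 0 = A"
proof -
  have "\<forall>\<^sub>F z in nhds 0. f z = F z"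
    using eventually_nhds_in_open[of unit_disc "0 :: complex"]
    by (auto elim!: eventually_mono intro: assms(2))
  then have "fps_expansion f 0 = fps_expansion F 0"
    by (rule fps_expansion_cong)
  also have "\<dots> = A"
    using assms(1) by (simp add: fps_eq_iff fps_expansion_def fps_nth_fps_expansion)
  finally show ?thesis .
qed

lemma has_fps_expansion_disc:
  "f holomorphic_on unit_disc \<Longrightarrow> f has_fps_expansion fps_expansion f 0"
  by (rule has_fps_expansion_fps_expansion[of unit_disc]) auto

lemma taylor_coeff_0 [simp]: "taylor_coeff f 0 = f 0"
  by (simp add: fps_expansion_def)

text \<open>Maximum modulus at an interior point. It isolates the unimodular constants in the Schur
  step and later gives strictness for Schwarz functions.\<close>

lemma constant_if_norm_attained:
  assumes "g holomorphic_on unit_disc" "\<And>z. z \<in> unit_disc \<Longrightarrow> norm (g z) \<le> 1"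
    and "w \<in> unit_disc" "norm (g w) = 1" "z \<in> unit_disc"
  shows "g z = g w"
proof -
  have "g constant_on unit_disc"
    by (rule maximum_modulus_principle[where U = unit_disc and \<xi> = w])
       (use assms in auto)
  then show ?thesis
    using assms by (auto simp: constant_on_def)
qed

text \<open>\<open>G\<close> is the Moebius transform of \<open>g\<close> that sends
  \<open>g 0\<close> to 0, divided by \<open>z\<close>; Schwarz's lemma bounds it by 1. With the
  denominator cleared the relation is polynomial in the power series and also makes sense when
  \<open>g\<close> is a unimodular constant.\<close>

lemma schur_step:
  assumes hol: "g holomorphic_on unit_disc" and le: "\<And>z. z \<in> unit_disc \<Longrightarrow> norm (g z) \<le> 1"
  obtains G where "G holomorphic_on unit_disc" "\<And>z. z \<in> unit_disc \<Longrightarrow> norm (G z) \<le> 1"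
    "fps_expansion g 0 - fps_const (g 0) =
       fps_X * fps_expansion G 0 * (1 - fps_const (cnj (g 0)) * fps_expansion g 0)"
proof -
  have "\<exists>G. G holomorphic_on unit_disc \<and> (\<forall>z\<in>unit_disc. norm (G z) \<le> 1) \<and>
            (\<forall>z\<in>unit_disc. g z - g 0 = z * G z * (1 - cnj (g 0) * g z))"
  proof (cases "\<exists>w\<in>unit_disc. norm (g w) = 1")
    case True
    then obtain w where w: "w \<in> unit_disc" "norm (g w) = 1" by auto
    have "g z = g w" if "z \<in> unit_disc" for z
      using constant_if_norm_attained[OF hol le w that] .
    then show ?thesis
      \<comment> \<open>Here \<open>g\<close> is constant, so \<open>g z - g 0\<close> vanishes and
        \<open>G = 0\<close> works.\<close>
      by (intro exI[of _ "\<lambda>_. 0"]) auto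
  next
    case False
    then have lt: "norm (g z) < 1" if "z \<in> unit_disc" for z
      using le[OF that] that by (metis order_le_less)
    define h where "h = (\<lambda>z. Moebius_function 0 (g 0) (g z))"
    have g0: "norm (g 0) < 1" using lt by auto
    have nz: "1 - cnj (g 0) * g z \<noteq> 0" if "z \<in> unit_disc" for z
    proof
      assume "1 - cnj (g 0) * g z = 0"
      then have "norm (cnj (g 0) * g z) = 1" by (metis eq_iff_diff_eq_0 norm_one)
      then show False using g0 lt[OF that] norm_mult_less[of "cnj (g 0)" 1 "g z" 1] by simp
    qed
    have hh: "h holomorphic_on unit_disc"
      unfolding h_def Moebius_function_simple using nz by (intro holomorphic_intros hol) auto
    have h0: "h 0 = 0" by (simp add: h_def Moebius_function_eq_zero)
    have hlt: "norm (h z) < 1" if "norm z < 1" for z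
      unfolding h_def using that lt by (intro Moebius_function_norm_lt_1) auto
    obtain G where G: "G holomorphic_on unit_disc" "\<And>z. norm z < 1 \<Longrightarrow> h z = z * G z"
      "deriv h 0 = G 0" using Schwarz3[OF hh h0] by metis
    have "norm (G z) \<le> 1" if "z \<in> unit_disc" for z
    proof (cases "z = 0")
      case True
      \<comment> \<open>At the origin dividing by \<open>z\<close> is impossible; there
        \<open>G 0\<close> is the derivative of \<open>h\<close>, which Schwarz's lemma bounds as
        well.\<close>
      then show ?thesis using Schwarz_Lemma(2)[OF hh h0 hlt, of 0] G(3) by simp
    next
      case False
      have "norm (h z) \<le> norm z" using that by (intro Schwarz_Lemma(1)[OF hh h0 hlt]) auto
      then show ?thesis using False G(2)[of z] that by (simp add: norm_mult)
    qed
    moreover have "g z - g 0 = z * G z * (1 - cnj (g 0) * g z)" if "z \<in> unit_disc" for z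
      using G(2)[of z] nz[OF that] that by (simp add: h_def Moebius_function_simple field_simps)
    ultimately show ?thesis using G(1) by blast
  qed
  then obtain G where G: "G holomorphic_on unit_disc" "\<And>z. z \<in> unit_disc \<Longrightarrow> norm (G z) \<le> 1"
    "\<And>z. z \<in> unit_disc \<Longrightarrow> g z - g 0 = z * G z * (1 - cnj (g 0) * g z)" by blast
  note E = has_fps_expansion_disc[OF hol] has_fps_expansion_disc[OF G(1)]
  have "fps_expansion (\<lambda>z. g z - g 0) 0 = fps_expansion g 0 - fps_const (g 0)"
    by (rule fps_expansion_eqI) (rule fps_expansion_intros E refl)+
  moreover have "fps_expansion (\<lambda>z. g z - g 0) 0 =
      fps_X * fps_expansion G 0 * (1 - fps_const (cnj (g 0)) * fps_expansion g 0)"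
    by (rule fps_expansion_eqI[OF _ G(3)]) (rule fps_expansion_intros E | assumption)+
  ultimately show ?thesis using that G by metis
qed

text \<open>Three Schur steps lead from \<open>\<omega>\<close> to \<open>f\<close>,
  \<open>g\<close> and \<open>h\<close>. The parameters are \<open>x = g 0\<close> and the first
  coefficient \<open>y\<close> of \<open>g\<close>, which equals
  \<open>(1 - |x|\<^sup>2) h 0\<close>; this gives the bound on \<open>y\<close>.\<close>

lemma schwarz_coeffs:
  assumes "schwarz_function \<omega>"
  obtains x y where "norm (taylor_coeff \<omega> 1) \<le> 1" "norm x \<le> 1" "norm y \<le> 1 - (norm x)\<^sup>2"
    "taylor_coeff \<omega> 2 = of_real (1 - (norm (taylor_coeff \<omega> 1))\<^sup>2) * x"
    "taylor_coeff \<omega> 3 = of_real (1 - (norm (taylor_coeff \<omega> 1))\<^sup>2) * (y - cnj (taylor_coeff \<omega> 1) * x\<^sup>2)"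
proof -
  have \<omega>: "\<omega> holomorphic_on unit_disc" "\<omega> 0 = 0" "\<And>z. z \<in> unit_disc \<Longrightarrow> norm (\<omega> z) \<le> 1"
    using assms by (auto simp: schwarz_function_def)
  obtain f where f: "f holomorphic_on unit_disc" "\<And>z. z \<in> unit_disc \<Longrightarrow> norm (f z) \<le> 1"
    "fps_expansion \<omega> 0 = fps_X * fps_expansion f 0"
    \<comment> \<open>Since \<open>\<omega> 0 = 0\<close>, the Moebius factor is 1 and the step only
      shifts the coefficients by one.\<close>
    using schur_step[OF \<omega>(1,3)] \<omega>(2) by auto
  obtain g where g: "g holomorphic_on unit_disc" "\<And>z. z \<in> unit_disc \<Longrightarrow> norm (g z) \<le> 1"
    "fps_expansion f 0 - fps_const (f 0) =
       fps_X * (fps_expansion g 0 * (1 - fps_const (cnj (f 0)) * fps_expansion f 0))"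
    using schur_step[OF f(1,2)] by (auto simp: mult.assoc)
  obtain h where h: "h holomorphic_on unit_disc" "\<And>z. z \<in> unit_disc \<Longrightarrow> norm (h z) \<le> 1"
    "fps_expansion g 0 - fps_const (g 0) =
       fps_X * (fps_expansion h 0 * (1 - fps_const (cnj (g 0)) * fps_expansion g 0))"
    using schur_step[OF g(1,2)] by (auto simp: mult.assoc)
  have n: "cnj z * z = of_real ((norm z)\<^sup>2)" for z
    by (metis complex_norm_square mult.commute)
  have c: "taylor_coeff \<omega> 1 = f 0" "taylor_coeff \<omega> 2 = taylor_coeff f 1"
      "taylor_coeff \<omega> 3 = taylor_coeff f 2"
    by (simp_all add: f(3))
  have f1: "taylor_coeff f 1 = of_real (1 - (norm (f 0))\<^sup>2) * g 0"
    using arg_cong[OF g(3), of "\<lambda>F. fps_nth F 1"] by (simp add: n)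
  have f2: "taylor_coeff f 2 =
      taylor_coeff g 1 * of_real (1 - (norm (f 0))\<^sup>2) - g 0 * (cnj (f 0) * taylor_coeff f 1)"
    using arg_cong[OF g(3), of "\<lambda>F. fps_nth F 2"] by (simp add: n)
  have g1: "taylor_coeff g 1 = of_real (1 - (norm (g 0))\<^sup>2) * h 0"
    using arg_cong[OF h(3), of "\<lambda>F. fps_nth F 1"] by (simp add: n)
  have le: "norm (f 0) \<le> 1" "norm (g 0) \<le> 1" "norm (h 0) \<le> 1"
    using f(2) g(2) h(2) by auto
  have sq: "(norm (g 0))\<^sup>2 \<le> 1" using le(2) by (simp add: power_le_one)
  have "norm (taylor_coeff g 1) = (1 - (norm (g 0))\<^sup>2) * norm (h 0)"
    unfolding g1 norm_mult norm_of_real using sq by simp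
  also have "\<dots> \<le> 1 - (norm (g 0))\<^sup>2"
    using le(3) sq by (simp add: mult_left_le)
  finally have y: "norm (taylor_coeff g 1) \<le> 1 - (norm (g 0))\<^sup>2" .
  have c3: "taylor_coeff f 2 = of_real (1 - (norm (f 0))\<^sup>2) * (taylor_coeff g 1 - cnj (f 0) * (g 0)\<^sup>2)"
    unfolding f2 f1 by (simp add: algebra_simps power2_eq_square)
  show ?thesis
    by (rule that[of "g 0" "taylor_coeff g 1"]) (use le y f1 c3 in \<open>simp_all only: c\<close>)
qed

text \<open>After the substitution for the second coefficient, the triangle inequality leaves a
  convex combination, with weights \<open>1 - |c|\<^sup>2\<close> and \<open>|c|\<^sup>2\<close>, of
  the numbers \<open>|x|\<close> and \<open>\<mu>\<close>, both at most 1.\<close>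

lemma fekete_szego_bound:
  assumes "schwarz_function \<omega>" "0 \<le> \<mu>" "\<mu> \<le> 1"
  shows "norm (taylor_coeff \<omega> 2 + of_real \<mu> * (taylor_coeff \<omega> 1)\<^sup>2) \<le> 1"
proof -
  define c where "c = taylor_coeff \<omega> 1"
  obtain x y where *: "norm c \<le> 1" "norm x \<le> 1"
    and x: "taylor_coeff \<omega> 2 = of_real (1 - (norm c)\<^sup>2) * x"
    using schwarz_coeffs[OF assms(1)] unfolding c_def by metis
  have sq: "(norm c)\<^sup>2 \<le> 1" using * by (simp add: power_le_one)
  have "norm (taylor_coeff \<omega> 2 + of_real \<mu> * c\<^sup>2) \<le> (1 - (norm c)\<^sup>2) * norm x + \<mu> * (norm c)\<^sup>2"
    unfolding x by (rule order_trans[OF norm_triangle_ineq])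
      (use assms sq in \<open>simp add: norm_mult norm_power del: of_real_diff of_real_power\<close>)
  also have "\<dots> \<le> (1 - (norm c)\<^sup>2) * 1 + 1 * (norm c)\<^sup>2"
    using * assms sq by (intro add_mono mult_left_mono mult_right_mono) auto
  finally show ?thesis unfolding c_def by simp
qed

text \<open>The triangle inequality reduces the claim to a real inequality in \<open>a = |c|\<close>
  and \<open>r = |x|\<close>. From \<open>1 - a\<^sup>2\<close> there is exactly
  \<open>a\<^sup>2\<close> to spare: half of it pays for the terms in \<open>x\<close>, half for the
  cubic term.\<close>

lemma third_coefficient_bound:
  assumes "schwarz_function \<omega>" "0 \<le> \<mu>" "\<mu> \<le> 1" "0 \<le> \<nu>" "\<nu> \<le> 1 / 2"
  shows "norm (taylor_coeff \<omega> 3 + of_real \<mu> * taylor_coeff \<omega> 1 * taylor_coeff \<omega> 2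
           + of_real \<nu> * (taylor_coeff \<omega> 1) ^ 3) \<le> 1"
proof -
  define c where "c = taylor_coeff \<omega> 1"
  obtain x y where *: "norm c \<le> 1" "norm x \<le> 1" "norm y \<le> 1 - (norm x)\<^sup>2"
    and c2: "taylor_coeff \<omega> 2 = of_real (1 - (norm c)\<^sup>2) * x"
    and c3: "taylor_coeff \<omega> 3 = of_real (1 - (norm c)\<^sup>2) * (y - cnj c * x\<^sup>2)"
    using schwarz_coeffs[OF assms(1)] unfolding c_def by metis
  define a r where "a = norm c" and "r = norm x"
  have a: "0 \<le> a" "a \<le> 1" and r: "0 \<le> r" using * by (auto simp: a_def r_def)
  have a2: "a\<^sup>2 \<le> 1" using a by (simp add: power_le_one)
  have "norm (taylor_coeff \<omega> 3 + of_real \<mu> * c * taylor_coeff \<omega> 2 + of_real \<nu> * c ^ 3)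
      = norm (of_real (1 - (norm c)\<^sup>2) * (y - cnj c * x\<^sup>2 + of_real \<mu> * c * x) + of_real \<nu> * c ^ 3)"
    unfolding c2 c3 by (simp add: algebra_simps)
  also have "\<dots> \<le> (1 - a\<^sup>2) * norm (y - cnj c * x\<^sup>2 + of_real \<mu> * c * x) + \<nu> * a ^ 3"
    by (rule order_trans[OF norm_triangle_ineq])
       (use assms a2 in \<open>simp add: norm_mult norm_power a_def del: of_real_diff of_real_power\<close>)
  also have "norm (y - cnj c * x\<^sup>2 + of_real \<mu> * c * x) \<le> norm y + norm (cnj c * x\<^sup>2) + norm (of_real \<mu> * c * x)"
    by (meson add_mono norm_triangle_ineq norm_triangle_ineq4 order.refl order_trans)
  also have "\<dots> \<le> 1 - r\<^sup>2 + a * r\<^sup>2 + \<mu> * a * r"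
    using *(3) assms by (simp add: norm_mult norm_power a_def r_def)
  finally have "norm (taylor_coeff \<omega> 3 + of_real \<mu> * c * taylor_coeff \<omega> 2 + of_real \<nu> * c ^ 3)
      \<le> (1 - a\<^sup>2) * (1 - r\<^sup>2 + a * r\<^sup>2 + \<mu> * a * r) + \<nu> * a ^ 3"
    using a2 by (simp add: mult_left_mono)
  \<comment> \<open>Splitting \<open>1 - a\<^sup>2\<close> as \<open>(1 + a) (1 - a)\<close> makes
    the bracket a quadratic in \<open>(1 - a) r\<close>, whose maximum is found by completing the
    square.\<close>
  also have "\<dots> = 1 - a\<^sup>2 + (1 + a) * (\<mu> * a * ((1 - a) * r) - ((1 - a) * r)\<^sup>2) + \<nu> * a ^ 3"
    by (simp add: algebra_simps power2_eq_square power3_eq_cube)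
  also have "\<dots> \<le> 1 - a\<^sup>2 + 2 * (a\<^sup>2 / 4) + a\<^sup>2 / 2"
  proof -
    have "0 \<le> (\<mu> * a / 2 - (1 - a) * r)\<^sup>2" by simp
    then have "\<mu> * a * ((1 - a) * r) - ((1 - a) * r)\<^sup>2 \<le> (\<mu> * a)\<^sup>2 / 4"
      by (simp add: power2_diff power_divide)
    also have "\<dots> \<le> a\<^sup>2 / 4"
      using a assms by (simp add: power_mono mult_left_le_one_le)
    finally have "(1 + a) * (\<mu> * a * ((1 - a) * r) - ((1 - a) * r)\<^sup>2) \<le> (1 + a) * (a\<^sup>2 / 4)"
      using a by (intro mult_left_mono) auto
    also have "\<dots> \<le> 2 * (a\<^sup>2 / 4)" using a by (intro mult_right_mono) auto
    moreover have "\<nu> * a ^ 3 \<le> 1 / 2 * a\<^sup>2"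
      using a assms by (intro mult_mono power_decreasing) auto
    ultimately show ?thesis by linarith
  qed
  also have "\<dots> = 1" by simp
  finally show ?thesis unfolding c_def .
qed

section \<open>Starlike functions\<close>

text \<open>The differential equation is solved by \<open>z\<close> times the exponential of a
  primitive of \<open>(q z - 1) / z\<close>. Positivity of \<open>Re q\<close> is used only for
  univalence.\<close>

lemma starlike_existence:
  assumes q: "q holomorphic_on unit_disc" "q 0 = 1" and pos: "\<And>z. z \<in> unit_disc \<Longrightarrow> Re (q z) > 0"
  obtains f where "f \<in> class_S" "\<And>z. z \<in> unit_disc \<Longrightarrow> z * deriv f z = f z * q z"
proof -
  have "(\<lambda>z. q z - 1) holomorphic_on unit_disc" by (intro holomorphic_intros q)
  then obtain h where h: "h holomorphic_on unit_disc" "\<And>z. norm z < 1 \<Longrightarrow> q z - 1 = z * h z"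
    using Schwarz3[of "\<lambda>z. q z - 1" 1] q(2) by auto
  obtain K where "\<And>z. z \<in> unit_disc \<Longrightarrow> (K has_field_derivative h z) (at z within unit_disc)"
    using holomorphic_convex_primitive'[OF convex_ball open_ball h(1)] by metis
  then have K: "(K has_field_derivative h z) (at z)" if "z \<in> unit_disc" for z
    using that by (metis at_within_open open_ball)
  \<comment> \<open>Subtracting \<open>K 0\<close> normalises the derivative at 0 to 1.\<close>
  define f where "f = (\<lambda>z. z * exp (K z - K 0))"
  have f': "(f has_field_derivative exp (K z - K 0) * q z) (at z)" if "z \<in> unit_disc" for z
  proof -
    have "q z = 1 + z * h z" using h(2)[of z] that by (simp add: algebra_simps)
    then show ?thesis unfolding f_def
      by (auto intro!: derivative_eq_intros K that simp: algebra_simps)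
  qed
  have d: "deriv f z = exp (K z - K 0) * q z" if "z \<in> unit_disc" for z
    using f'[OF that] by (rule DERIV_imp_deriv)
  have hol: "f holomorphic_on unit_disc"
    unfolding holomorphic_on_open[OF open_ball] using f' by blast
  \<comment> \<open>Up to the additive constant \<open>K 0\<close> this is a logarithm of
    \<open>f (exp s)\<close> on the left half-plane, and its derivative is
    \<open>q (exp s)\<close>.\<close>
  define F where "F = (\<lambda>s. s + K (exp s))"
  have F_inj: "s = t" if st: "F s = F t" "Re s < 0" "Re t < 0" for s t
  proof (rule ccontr)
    assume ne: "s \<noteq> t"
    have F': "(F has_field_derivative q (exp u)) (at u)" if "Re u < 0" for u
    proof -
      have "exp u \<in> unit_disc" using that by simp
      moreover from this have "q (exp u) = 1 + exp u * h (exp u)"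
        using h(2)[of "exp u"] by (simp add: algebra_simps)
      ultimately show ?thesis unfolding F_def
        by (auto intro!: derivative_eq_intros DERIV_chain2[OF K] simp: algebra_simps)
    qed
    have seg: "Re u < 0" if "u \<in> closed_segment s t" for u
      using closed_segment_subset[of s "{z. Re z < 0}" t] st(2,3) that convex_halfspace_Re_lt
      by auto
    \<comment> \<open>The mean value theorem is only available for real parts; dividing by \<open>t - s\<close> makes the
      increment of \<open>u\<close> real.\<close>
    have "\<exists>u. u \<in> closed_segment s t \<and>
        Re (F t / (t - s)) - Re (F s / (t - s)) = Re (q (exp u) / (t - s) * (t - s))"
      by (rule complex_mvt_line) (use seg F' in \<open>auto intro!: DERIV_cdivide\<close>)
    then obtain u where u: "u \<in> closed_segment s t" "Re (q (exp u)) = 0"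
      using st(1) ne by auto
    then show False using pos[of "exp u"] seg[OF u(1)] by simp
  qed
  have zero: "f z = 0 \<longleftrightarrow> z = 0" for z by (simp add: f_def)
  have "inj_on f unit_disc"
  proof (rule inj_onI)
    fix z w assume zw: "z \<in> unit_disc" "w \<in> unit_disc" "f z = f w"
    show "z = w"
    proof (cases "z = 0 \<or> w = 0")
      case True
      then show ?thesis using zero zw(3) by metis
    next
      case False
      define s t where "s = Ln z" and "t = Ln w"
      have e: "exp s = z" "exp t = w" using False by (auto simp: s_def t_def)
      have neg: "Re s < 0" "Re t < 0"
        using zw(1,2) False by (auto simp: s_def t_def)
      have "exp (F s) = exp (F t)"
        using zw(3) by (simp add: F_def f_def e exp_add exp_diff)
      then obtain n :: int where n: "F s = F t + of_int (2 * n) * pi * \<i>"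
        by (auto simp: exp_eq)
      \<comment> \<open>Shifting \<open>t\<close> by a period of \<open>exp\<close> shifts
        \<open>F\<close> by the same amount, which absorbs the ambiguity of the logarithm without
        changing \<open>w\<close>.\<close>
      define t' where "t' = t + of_int (2 * n) * pi * \<i>"
      have t': "exp t' = exp t" by (auto simp: t'_def exp_eq)
      then have "F t' = F s" by (simp add: F_def n t'_def[symmetric]) (simp add: t'_def n[unfolded F_def] F_def)
      moreover have "Re t' < 0" using neg(2) by (simp add: t'_def)
      ultimately show ?thesis using F_inj neg(1) e t' by metis
    qed
  qed
  moreover have "taylor_coeff f 1 = 1"
    using d[of 0] q(2) by (simp add: fps_expansion_def)
  ultimately have "f \<in> class_S"
    using hol zero by (simp add: class_S_def class_A_def)
  then show ?thesis
    by (rule that) (simp add: d, simp add: f_def)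
qed

section \<open>Schwarz functions under the arcsine, and the class as solutions of a differential
  equation\<close>

lemma schwarz_function_norm_less:
  assumes "schwarz_function \<omega>" "z \<in> unit_disc"
  shows "norm (\<omega> z) < 1"
proof (rule ccontr)
  assume "\<not> norm (\<omega> z) < 1"
  then have "norm (\<omega> z) = 1" using assms by (force simp: schwarz_function_def)
  then have "\<omega> 0 = \<omega> z"
    using assms by (intro constant_if_norm_attained) (auto simp: schwarz_function_def)
  then show False using assms \<open>norm (\<omega> z) = 1\<close> by (simp add: schwarz_function_def)
qed

text \<open>The values stay in a strip that avoids the branch cuts of \<open>Arcsin\<close>.\<close>

lemma abs_Re_schwarz_less: "schwarz_function \<omega> \<Longrightarrow> z \<in> unit_disc \<Longrightarrow> \<bar>Re (\<omega> z)\<bar> < 1"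
  using schwarz_function_norm_less abs_Re_le_cmod order_le_less_trans by metis

lemma Arcsin_schwarz_holomorphic:
  assumes "schwarz_function \<omega>"
  shows "(\<lambda>z. Arcsin (\<omega> z)) holomorphic_on unit_disc"
proof -
  have "Arcsin \<circ> \<omega> holomorphic_on unit_disc"
    using assms abs_Re_schwarz_less[OF assms]
    by (intro holomorphic_on_compose holomorphic_on_Arcsin) (auto simp: schwarz_function_def)
  then show ?thesis by (simp add: o_def)
qed

lemma starlike_arcsin_existence:
  assumes "schwarz_function \<omega>"
  obtains f where "f \<in> starlike_arcsin"
    "\<forall>z\<in>unit_disc. z * deriv f z = f z * (1 + 2 / of_real pi * Arcsin (\<omega> z))"
proof -
  define q where "q = (\<lambda>z. 1 + 2 / of_real pi * Arcsin (\<omega> z))"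
  have "\<omega> 0 = 0" using assms by (simp add: schwarz_function_def)
  have "q holomorphic_on unit_disc"
    unfolding q_def by (intro holomorphic_intros Arcsin_schwarz_holomorphic assms) auto
  moreover have q0: "q 0 = 1" by (simp add: q_def \<open>\<omega> 0 = 0\<close>)
  moreover have "Re (q z) > 0" if "z \<in> unit_disc" for z
  proof -
    have "q z = 1 + (2 / pi) *\<^sub>R Arcsin (\<omega> z)" by (simp add: q_def scaleR_conv_of_real)
    then have "Re (q z) = 2 / pi * (Re (Arcsin (\<omega> z)) - (- (pi / 2)))"
      by (simp add: field_simps)
    \<comment> \<open>The factor \<open>2 / pi\<close> scales this bound to -1, just enough to make
      \<open>Re (q z)\<close> positive.\<close>
    moreover have "Re (Arcsin (\<omega> z)) > - (pi / 2)"
      using Arcsin_bounds[OF abs_Re_schwarz_less[OF assms that]] by linarith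
    ultimately show ?thesis by simp
  qed
  ultimately obtain f where f: "f \<in> class_S" "\<And>z. z \<in> unit_disc \<Longrightarrow> z * deriv f z = f z * q z"
    using starlike_existence[of q] by blast
  have f0: "f 0 = 0" and inj: "inj_on f unit_disc"
    using f(1) by (auto simp: class_S_def class_A_def)
  have "starlike_quotient f z = q z" if "z \<in> unit_disc" for z
  proof (cases "z = 0")
    case False
    then have "f z \<noteq> 0" using f0 inj that by (metis centre_in_ball inj_onD zero_less_one)
    then show ?thesis using f(2)[OF that] False by (simp add: starlike_quotient_def)
  qed (simp add: starlike_quotient_def q0)
  then have "f \<in> starlike_arcsin"
    using f(1) assms by (auto simp: starlike_arcsin_def subordinate_def q_def)
  then show ?thesis using f(2) that unfolding q_def by blast
qed

text \<open>Univalence keeps \<open>f z\<close> nonzero off the origin, so the denominator can be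
  cleared; the resulting identity holds at 0 too and can be compared as power series.\<close>

lemma starlike_arcsin_ode:
  assumes "f \<in> starlike_arcsin"
  obtains \<omega> where "schwarz_function \<omega>"
    "\<forall>z\<in>unit_disc. z * deriv f z = f z * (1 + 2 / of_real pi * Arcsin (\<omega> z))"
proof -
  obtain \<omega> where \<omega>: "schwarz_function \<omega>"
    "\<And>z. z \<in> unit_disc \<Longrightarrow> starlike_quotient f z = 1 + 2 / of_real pi * Arcsin (\<omega> z)"
    using assms by (auto simp: starlike_arcsin_def subordinate_def)
  have f0: "f 0 = 0" and inj: "inj_on f unit_disc"
    using assms by (auto simp: starlike_arcsin_def class_S_def class_A_def)
  have "z * deriv f z = f z * (1 + 2 / of_real pi * Arcsin (\<omega> z))" if "z \<in> unit_disc" for z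
  proof (cases "z = 0")
    case False
    then have "f z \<noteq> 0" using f0 inj that by (metis centre_in_ball inj_onD zero_less_one)
    then show ?thesis using \<omega>(2)[OF that] False by (simp add: starlike_quotient_def field_simps)
  qed (simp add: f0)
  then show ?thesis using that \<omega>(1) by blast
qed

section \<open>Coefficients of the class\<close>

text \<open>No series of \<open>Arcsin\<close> is expanded: \<open>sin\<close> of the composite is
  \<open>\<omega>\<close>, so the sine series expresses the coefficients of \<open>\<omega>\<close>
  by those sought, and these relations are solved. The term -1/6 of the sine changes sign on the
  way.\<close>

lemma Arcsin_schwarz_coeffs:
  assumes "schwarz_function \<omega>"
  shows "taylor_coeff (\<lambda>z. Arcsin (\<omega> z)) 1 = taylor_coeff \<omega> 1"
    "taylor_coeff (\<lambda>z. Arcsin (\<omega> z)) 2 = taylor_coeff \<omega> 2"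
    "taylor_coeff (\<lambda>z. Arcsin (\<omega> z)) 3 = taylor_coeff \<omega> 3 + (taylor_coeff \<omega> 1) ^ 3 / 6"
proof -
  define A where "A = fps_expansion (\<lambda>z. Arcsin (\<omega> z)) 0"
  have A0: "fps_nth A 0 = 0" using assms by (simp add: A_def schwarz_function_def)
  have "(\<lambda>z. Arcsin (\<omega> z)) has_fps_expansion A"
    unfolding A_def by (intro has_fps_expansion_disc Arcsin_schwarz_holomorphic assms)
  then have "(sin \<circ> (\<lambda>z. Arcsin (\<omega> z))) has_fps_expansion (fps_sin 1 oo A)"
    using A0 by (intro has_fps_expansion_compose has_fps_expansion_sin')
  then have W: "fps_expansion \<omega> 0 = fps_sin 1 oo A"
    by (rule fps_expansion_eqI) simp
  have s: "fps_nth (fps_sin (1::complex)) 0 = 0" "fps_nth (fps_sin (1::complex)) 1 = 1"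
    "fps_nth (fps_sin (1::complex)) 2 = 0" "fps_nth (fps_sin (1::complex)) 3 = - 1 / 6"
    by (simp_all add: fps_sin_def fact_numeral)
  have W1: "taylor_coeff \<omega> 1 = fps_nth A 1"
    by (simp add: W fps_compose_nth s[simplified])
  have W2: "taylor_coeff \<omega> 2 = fps_nth A 2"
    using s A0 by (simp add: W fps_compose_nth numeral_2_eq_2)
  have W3: "taylor_coeff \<omega> 3 = fps_nth A 3 - fps_nth A 1 ^ 3 / 6"
    using s A0 by (simp add: W fps_compose_nth numeral_2_eq_2 numeral_3_eq_3 fps_mult_nth)
  show "taylor_coeff (\<lambda>z. Arcsin (\<omega> z)) 1 = taylor_coeff \<omega> 1"
    "taylor_coeff (\<lambda>z. Arcsin (\<omega> z)) 2 = taylor_coeff \<omega> 2"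
    "taylor_coeff (\<lambda>z. Arcsin (\<omega> z)) 3 = taylor_coeff \<omega> 3 + (taylor_coeff \<omega> 1) ^ 3 / 6"
    using W1 W2 W3 by (simp_all add: A_def)
qed

text \<open>With \<open>k = 2 / pi\<close>, the constants of the fourth coefficient are
  \<open>3 / pi = 3 k / 2\<close> and \<open>2 / pi\<^sup>2 = k\<^sup>2 / 2\<close>; the summand 1/6
  comes from the arcsine.\<close>

lemma starlike_arcsin_coeffs:
  assumes f: "f \<in> starlike_arcsin" and \<omega>: "schwarz_function \<omega>"
    and ode: "\<forall>z\<in>unit_disc. z * deriv f z = f z * (1 + 2 / of_real pi * Arcsin (\<omega> z))"
  shows "taylor_coeff f 2 = of_real (2 / pi) * taylor_coeff \<omega> 1"
    "taylor_coeff f 3 = of_real (1 / pi) *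
       (taylor_coeff \<omega> 2 + of_real (2 / pi) * (taylor_coeff \<omega> 1)\<^sup>2)"
    "taylor_coeff f 4 = of_real (2 / (3 * pi)) *
       (taylor_coeff \<omega> 3 + of_real (3 / pi) * taylor_coeff \<omega> 1 * taylor_coeff \<omega> 2
         + of_real (2 / pi\<^sup>2 + 1 / 6) * (taylor_coeff \<omega> 1) ^ 3)"
proof -
  define F where "F = fps_expansion f 0"
  define A where "A = fps_expansion (\<lambda>z. Arcsin (\<omega> z)) 0"
  define k where "k = (2 / of_real pi :: complex)"
  have hol: "f holomorphic_on unit_disc" and F01: "fps_nth F 0 = 0" "fps_nth F 1 = 1"
    using f by (auto simp: starlike_arcsin_def class_S_def class_A_def F_def)
  have A0: "fps_nth A 0 = 0" using \<omega> by (simp add: A_def schwarz_function_def)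
  have E: "f has_fps_expansion F" "(\<lambda>z. Arcsin (\<omega> z)) has_fps_expansion A"
    unfolding A_def F_def
    by (intro has_fps_expansion_disc hol Arcsin_schwarz_holomorphic \<omega>)+
  have "fps_expansion (\<lambda>z. z * deriv f z) 0 = fps_X * fps_deriv F"
    by (rule fps_expansion_eqI) (rule fps_expansion_intros E refl)+
  moreover have "fps_expansion (\<lambda>z. z * deriv f z) 0 = F * (1 + fps_const k * A)"
    by (rule fps_expansion_eqI[OF _ ode[rule_format]]) (unfold k_def, (rule fps_expansion_intros E | assumption)+)
  ultimately have eq: "fps_X * fps_deriv F = F * (1 + fps_const k * A)" by simp
  note co = Arcsin_schwarz_coeffs[OF \<omega>, folded A_def]
  note N = fps_mult_nth numeral_2_eq_2 numeral_3_eq_3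
  \<comment> \<open>At degree \<open>n\<close> the left side of \<open>eq\<close> contributes
    \<open>n\<close> times the coefficient of \<open>F\<close> and the right side one copy of it,
    which leaves the factors 1, 2, 3 here and below.\<close>
  have a2: "fps_nth F 2 = k * fps_nth A 1"
    using arg_cong[OF eq, of "\<lambda>G. fps_nth G 2"] F01 A0 by (simp add: N)
  have a3: "2 * fps_nth F 3 = k * (fps_nth F 2 * fps_nth A 1 + fps_nth A 2)"
    using arg_cong[OF eq, of "\<lambda>G. fps_nth G 3"] F01 A0 by (simp add: N algebra_simps)
  have a4: "3 * fps_nth F 4 = k * (fps_nth F 3 * fps_nth A 1 + fps_nth F 2 * fps_nth A 2 + fps_nth A 3)"
    using arg_cong[OF eq, of "\<lambda>G. fps_nth G 4"] F01 A0
    by (simp add: N eval_nat_numeral algebra_simps)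
  show "taylor_coeff f 2 = of_real (2 / pi) * taylor_coeff \<omega> 1"
    using a2 by (simp add: F_def[symmetric] co k_def del: One_nat_def)
  have a3': "fps_nth F 3 = k / 2 * (fps_nth A 2 + k * (fps_nth A 1)\<^sup>2)"
    using a3 unfolding a2 by (simp add: field_simps power2_eq_square)
  then show "taylor_coeff f 3 = of_real (1 / pi) *
       (taylor_coeff \<omega> 2 + of_real (2 / pi) * (taylor_coeff \<omega> 1)\<^sup>2)"
    by (simp add: F_def[symmetric] co k_def del: One_nat_def)
  have "fps_nth F 4 = k / 3 * (fps_nth A 3 + 3 * k / 2 * fps_nth A 1 * fps_nth A 2
      + k\<^sup>2 / 2 * (fps_nth A 1) ^ 3)"
    using a4 unfolding a2 a3' by (simp add: field_simps power2_eq_square power3_eq_cube)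
  then show "taylor_coeff f 4 = of_real (2 / (3 * pi)) *
       (taylor_coeff \<omega> 3 + of_real (3 / pi) * taylor_coeff \<omega> 1 * taylor_coeff \<omega> 2
         + of_real (2 / pi\<^sup>2 + 1 / 6) * (taylor_coeff \<omega> 1) ^ 3)"
    by (simp add: F_def[symmetric] co k_def power_divide algebra_simps del: One_nat_def)
qed

section \<open>Extremal functions and the sharp bounds\<close>

lemma schwarz_function_power: "n > 0 \<Longrightarrow> schwarz_function (\<lambda>z. z ^ n)"
  by (auto simp: schwarz_function_def norm_power power_le_one intro!: holomorphic_intros)

lemma taylor_coeff_power: "taylor_coeff (\<lambda>z. z ^ n) m = (if m = n then 1 else 0)"
  using fps_expansion_eqI[OF has_fps_expansion_fps_X_power refl, of n] by simp

theorem theorem3p1: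
  "(\<forall>f\<in>starlike_arcsin.
      norm (taylor_coeff f 2) \<le> 2 / pi \<and>
      norm (taylor_coeff f 3) \<le> 1 / pi \<and>
      norm (taylor_coeff f 4) \<le> 2 / (3 * pi)) \<and>
   (\<exists>f\<in>starlike_arcsin. norm (taylor_coeff f 2) = 2 / pi) \<and>
   (\<exists>f\<in>starlike_arcsin. norm (taylor_coeff f 3) = 1 / pi) \<and>
   (\<exists>f\<in>starlike_arcsin. norm (taylor_coeff f 4) = 2 / (3 * pi))"
proof (intro conjI ballI)
  fix f assume f: "f \<in> starlike_arcsin"
  obtain \<omega> where \<omega>: "schwarz_function \<omega>"
    "\<forall>z\<in>unit_disc. z * deriv f z = f z * (1 + 2 / of_real pi * Arcsin (\<omega> z))"
    using starlike_arcsin_ode[OF f] by blast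
  note co = starlike_arcsin_coeffs[OF f \<omega>]
  \<comment> \<open>This puts \<open>2 / pi\<close> and \<open>3 / pi\<close> below 1 and
    \<open>2 / pi\<^sup>2 + 1 / 6\<close> below 7/18, as the two coefficient bounds require.\<close>
  have "3 < pi" using pi_approx by simp
  then have "3\<^sup>2 \<le> pi\<^sup>2" by (intro power_mono) auto
  then have "2 / pi\<^sup>2 \<le> 2 / 3\<^sup>2" by (intro divide_left_mono) auto
  then have nu: "2 / pi\<^sup>2 + 1 / 6 \<le> 1 / 2" by simp
  have "norm (taylor_coeff \<omega> 1) \<le> 1"
    using schwarz_coeffs[OF \<omega>(1)] by metis
  then show "norm (taylor_coeff f 2) \<le> 2 / pi"
    unfolding co norm_mult norm_of_real by (simp add: divide_right_mono)
  have "norm (taylor_coeff \<omega> 2 + of_real (2 / pi) * (taylor_coeff \<omega> 1)\<^sup>2) \<le> 1"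
    using \<open>3 < pi\<close> by (intro fekete_szego_bound \<omega>(1)) auto
  then show "norm (taylor_coeff f 3) \<le> 1 / pi"
    unfolding co norm_mult norm_of_real by (simp add: divide_right_mono)
  have "norm (taylor_coeff \<omega> 3 + of_real (3 / pi) * taylor_coeff \<omega> 1 * taylor_coeff \<omega> 2
         + of_real (2 / pi\<^sup>2 + 1 / 6) * (taylor_coeff \<omega> 1) ^ 3) \<le> 1"
    using \<open>3 < pi\<close> nu by (intro third_coefficient_bound \<omega>(1)) auto
  then have "2 / (3 * pi) * norm (taylor_coeff \<omega> 3 + of_real (3 / pi) * taylor_coeff \<omega> 1 * taylor_coeff \<omega> 2
         + of_real (2 / pi\<^sup>2 + 1 / 6) * (taylor_coeff \<omega> 1) ^ 3) \<le> 2 / (3 * pi)"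
    by (intro mult_left_le) auto
  then show "norm (taylor_coeff f 4) \<le> 2 / (3 * pi)"
    unfolding co norm_mult norm_of_real by simp
next
  \<comment> \<open>For \<open>\<omega> z = z ^ n\<close> the only nonzero coefficient is the
    \<open>n\<close>-th, so just the leading term of the formula survives; \<open>n = 2\<close>
    gives \<open>2 / (2 * pi) = 1 / pi\<close>.\<close>
  have *: "\<exists>f\<in>starlike_arcsin. norm (taylor_coeff f (Suc n)) = 2 / (n * pi)"
    if n: "n \<in> {1, 2, 3}" for n
  proof -
    have s: "schwarz_function (\<lambda>z. z ^ n)"
      using n by (intro schwarz_function_power) auto
    obtain f where f: "f \<in> starlike_arcsin"
      "\<forall>z\<in>unit_disc. z * deriv f z = f z * (1 + 2 / of_real pi * Arcsin (z ^ n))"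
      using starlike_arcsin_existence[OF s] by blast
    note co = starlike_arcsin_coeffs[OF f(1) s f(2), unfolded taylor_coeff_power]
    have "norm (taylor_coeff f (Suc n)) = 2 / (n * pi)"
      using n co by (auto simp: norm_mult norm_divide numeral_2_eq_2[symmetric])
    then show ?thesis using f(1) by blast
  qed
  show "\<exists>f\<in>starlike_arcsin. norm (taylor_coeff f 2) = 2 / pi"
    using *[of 1] by (simp add: numeral_2_eq_2)
  show "\<exists>f\<in>starlike_arcsin. norm (taylor_coeff f 3) = 1 / pi"
    using *[of 2] by simp
  show "\<exists>f\<in>starlike_arcsin. norm (taylor_coeff f 4) = 2 / (3 * pi)"
    using *[of 3] by simp
qed

end
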